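(* Identifying each of the logics $\mathbf{HT}$, $\mathbf{SF}$, $\mathbf{CPC}$ with its set of theorems, $$\mathbf{HT}\subsetneq\mathbf{SF}\subsetneq\mathbf{CPC}.$$
   Context: Formulas: $\mathrm{Var}$ is a countable set of variables; $\mathrm{Form}$ is generated from $\bot$ and $\mathrm{Var}$ by $\land,\lor,\to$; $\neg A$ abbreviates $A\to\bot$. $\mathbf{CPC}$ is classical propositional logic. $\mathbf{HT}$ is the logic of here-and-there, the intermediate logic axiomatised over intuitionistic propositional logic by $A\lor(A\to B)\lor\neg B$; it is characterised by the 2-node intuitionistic Kripke models, i.e. $A$ is a theorem of $\mathbf{HT}$ iff $A$ is intuitionistically forced at every node of every intuitionistic Kripke model whose frame is a two-element chain $k<k'$. $\mathbf{SF}$ is the following sequent calculus, and its theorems are the formulas $A$ such that $\vdash A$ (empty left side) is derivable. Sequents are $\Gamma\vdash\Delta$ with $\Gamma,\Delta$ finite sequences of formulas; $\neg\neg\Gamma$ denotes the result of replacing each member $A$ by $\neg\neg A$. Initial sequents: $\bot\vdash$ and $p\vdash p$ for $p\in\mathrm{Var}$. Structural rules: those of Gentzen's classical calculus $\mathbf{LK}$ (weakening, contraction, exchange on both sides, and cut). Logical rules: ($\land$L) from $A,\Gamma\vdash\Delta$ infer $B\land A,\Gamma\vdash\Delta$; from $A,\Gamma\vdash\Delta$ infer $A\land B,\Gamma\vdash\Delta$. ($\land$R) from $\Gamma\vdash\Delta,A$ and $\Gamma\vdash\Delta,B$ infer $\Gamma\vdash\Delta,A\land B$. ($\lor$L) from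 $A,\Gamma\vdash\Delta$ and $B,\Gamma\vdash\Delta$ infer $A\lor B,\Gamma\vdash\Delta$. ($\lor$R) from $\Gamma\vdash\Delta,A$ infer $\Gamma\vdash\Delta,A\lor B$; from $\Gamma\vdash\Delta,A$ infer $\Gamma\vdash\Delta,B\lor A$. ($\to$L) from $\Gamma\vdash\Delta,A$ and $B,\Pi\vdash\Sigma$ infer $\Gamma,A\to B,\Pi\vdash\Delta,\neg\neg\Sigma$. ($\to$R) from $\Gamma,A\vdash\neg\neg B,\Delta$ infer $\Gamma\vdash A\to B,\neg\neg\Delta$. *)

theory Defs
  imports Main "HOL-Library.Countable"
begin

datatype 'v form =
    Bot
  | Var 'v
  | And "'v form" "'v form"  (infixr "\<^bold>\<and>" 65)
  | Or "'v form" "'v form"   (infixr "\<^bold>\<or>" 60)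
  | Imp "'v form" "'v form"  (infixr "\<^bold>\<rightarrow>" 55)

abbreviation Neg :: "'v form \<Rightarrow> 'v form"  ("\<^bold>\<not> _" [70] 70) where
  "\<^bold>\<not> A \<equiv> A \<^bold>\<rightarrow> Bot"

text \<open>Derivability in the Hilbert calculus of intuitionistic propositional logic from
  additional axioms. Modus ponens is the only rule, so an axiom scheme has to be passed as
  the set of all its instances.\<close>

inductive hilbert :: "'v form set \<Rightarrow> 'v form \<Rightarrow> bool" for Ax :: "'v form set" where
  axiom: "A \<in> Ax \<Longrightarrow> hilbert Ax A"
| K: "hilbert Ax (A \<^bold>\<rightarrow> B \<^bold>\<rightarrow> A)"
| S: "hilbert Ax ((A \<^bold>\<rightarrow> B \<^bold>\<rightarrow> C) \<^bold>\<rightarrow> (A \<^bold>\<rightarrow> B) \<^bold>\<rightarrow> A \<^bold>\<rightarrow> C)"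
| conjI: "hilbert Ax (A \<^bold>\<rightarrow> B \<^bold>\<rightarrow> A \<^bold>\<and> B)"
| conjE1: "hilbert Ax (A \<^bold>\<and> B \<^bold>\<rightarrow> A)"
| conjE2: "hilbert Ax (A \<^bold>\<and> B \<^bold>\<rightarrow> B)"
| disjI1: "hilbert Ax (A \<^bold>\<rightarrow> A \<^bold>\<or> B)"
| disjI2: "hilbert Ax (B \<^bold>\<rightarrow> A \<^bold>\<or> B)"
| disjE: "hilbert Ax ((A \<^bold>\<rightarrow> C) \<^bold>\<rightarrow> (B \<^bold>\<rightarrow> C) \<^bold>\<rightarrow> A \<^bold>\<or> B \<^bold>\<rightarrow> C)"
| botE: "hilbert Ax (Bot \<^bold>\<rightarrow> A)"
| mp: "hilbert Ax (A \<^bold>\<rightarrow> B) \<Longrightarrow> hilbert Ax A \<Longrightarrow> hilbert Ax B"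

definition HT :: "'v form set" where
  "HT = {C. hilbert {A \<^bold>\<or> (A \<^bold>\<rightarrow> B) \<^bold>\<or> \<^bold>\<not> B | A B. True} C}"

definition CPC :: "'v form set" where
  "CPC = {C. hilbert {A \<^bold>\<or> \<^bold>\<not> A | A. True} C}"

abbreviation NNs :: "'v form list \<Rightarrow> 'v form list" where
  "NNs \<equiv> map (\<lambda>A. \<^bold>\<not> \<^bold>\<not> A)"

inductive SF_seq :: "'v form list \<Rightarrow> 'v form list \<Rightarrow> bool"  (infix "\<turnstile>" 50) where
  init_bot: "[Bot] \<turnstile> []"
| init_var: "[Var p] \<turnstile> [Var p]"
| weakL: "\<Gamma> \<turnstile> \<Delta> \<Longrightarrow> A # \<Gamma> \<turnstile> \<Delta>"
| weakR: "\<Gamma> \<turnstile> \<Delta> \<Longrightarrow> \<Gamma> \<turnstile> \<Delta> @ [A]"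
| contrL: "A # A # \<Gamma> \<turnstile> \<Delta> \<Longrightarrow> A # \<Gamma> \<turnstile> \<Delta>"
| contrR: "\<Gamma> \<turnstile> \<Delta> @ [A, A] \<Longrightarrow> \<Gamma> \<turnstile> \<Delta> @ [A]"
| exchL: "\<Gamma> @ [A, B] @ \<Pi> \<turnstile> \<Delta> \<Longrightarrow> \<Gamma> @ [B, A] @ \<Pi> \<turnstile> \<Delta>"
| exchR: "\<Gamma> \<turnstile> \<Delta> @ [A, B] @ \<Sigma> \<Longrightarrow> \<Gamma> \<turnstile> \<Delta> @ [B, A] @ \<Sigma>"
| cut: "\<Gamma> \<turnstile> \<Delta> @ [A] \<Longrightarrow> A # \<Pi> \<turnstile> \<Sigma> \<Longrightarrow> \<Gamma> @ \<Pi> \<turnstile> \<Delta> @ \<Sigma>"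
| conjL1: "A # \<Gamma> \<turnstile> \<Delta> \<Longrightarrow> (B \<^bold>\<and> A) # \<Gamma> \<turnstile> \<Delta>"
| conjL2: "A # \<Gamma> \<turnstile> \<Delta> \<Longrightarrow> (A \<^bold>\<and> B) # \<Gamma> \<turnstile> \<Delta>"
| conjR: "\<Gamma> \<turnstile> \<Delta> @ [A] \<Longrightarrow> \<Gamma> \<turnstile> \<Delta> @ [B] \<Longrightarrow> \<Gamma> \<turnstile> \<Delta> @ [A \<^bold>\<and> B]"
| disjL: "A # \<Gamma> \<turnstile> \<Delta> \<Longrightarrow> B # \<Gamma> \<turnstile> \<Delta> \<Longrightarrow> (A \<^bold>\<or> B) # \<Gamma> \<turnstile> \<Delta>"
| disjR1: "\<Gamma> \<turnstile> \<Delta> @ [A] \<Longrightarrow> \<Gamma> \<turnstile> \<Delta> @ [A \<^bold>\<or> B]"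
| disjR2: "\<Gamma> \<turnstile> \<Delta> @ [A] \<Longrightarrow> \<Gamma> \<turnstile> \<Delta> @ [B \<^bold>\<or> A]"
| impL: "\<Gamma> \<turnstile> \<Delta> @ [A] \<Longrightarrow> B # \<Pi> \<turnstile> \<Sigma> \<Longrightarrow> \<Gamma> @ [A \<^bold>\<rightarrow> B] @ \<Pi> \<turnstile> \<Delta> @ NNs \<Sigma>"
| impR: "\<Gamma> @ [A] \<turnstile> (\<^bold>\<not> \<^bold>\<not> B) # \<Delta> \<Longrightarrow> \<Gamma> \<turnstile> (A \<^bold>\<rightarrow> B) # NNs \<Delta>"

definition SF :: "'v form set" where
  "SF = {A. [] \<turnstile> [A]}"

end

(* Both HT and SF are evaluated on a two-element chain, given by the variables H forced at the lower
   node and the variables T forced at the upper one, with H a subset of T.  Only implication differs: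
   at the lower node SF evaluates it as at the upper one, that is, it reads A -> B as the
   intuitionistic A -> ~~B.  Hence SF forces more than HT, and soundness of HT, soundness and
   completeness of SF and completeness of CPC reduce the inclusions to a comparison of models; the
   formulas ~~p -> p and p or ~p separate the logics.  Completeness of SF and of CPC follows Kalmar's
   method. *)
theory Submission
  imports Defs
begin

section \<open>Semantics\<close>

primrec cl :: "'v set \<Rightarrow> 'v form \<Rightarrow> bool" where
  "cl T Bot = False"
| "cl T (Var p) = (p \<in> T)"
| "cl T (A \<^bold>\<and> B) = (cl T A \<and> cl T B)"
| "cl T (A \<^bold>\<or> B) = (cl T A \<or> cl T B)"
| "cl T (A \<^bold>\<rightarrow> B) = (cl T A \<longrightarrow> cl T B)"

text \<open>The upper node sees only itself, so forcing there is \<open>cl T\<close>. The second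
  conjunct in the clause for implication is its condition at the upper node.\<close>

primrec ht :: "'v set \<Rightarrow> 'v set \<Rightarrow> 'v form \<Rightarrow> bool" where
  "ht H T Bot = False"
| "ht H T (Var p) = (p \<in> H)"
| "ht H T (A \<^bold>\<and> B) = (ht H T A \<and> ht H T B)"
| "ht H T (A \<^bold>\<or> B) = (ht H T A \<or> ht H T B)"
| "ht H T (A \<^bold>\<rightarrow> B) = ((ht H T A \<longrightarrow> ht H T B) \<and> (cl T A \<longrightarrow> cl T B))"

primrec sf :: "'v set \<Rightarrow> 'v set \<Rightarrow> 'v form \<Rightarrow> bool" where
  "sf H T Bot = False"
| "sf H T (Var p) = (p \<in> H)"
| "sf H T (A \<^bold>\<and> B) = (sf H T A \<and> sf H T B)"
| "sf H T (A \<^bold>\<or> B) = (sf H T A \<or> sf H T B)"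
| "sf H T (A \<^bold>\<rightarrow> B) = (cl T A \<longrightarrow> cl T B)"

lemma ht_imp_cl: "H \<subseteq> T \<Longrightarrow> ht H T A \<Longrightarrow> cl T A"
  by (induction A) auto

lemma sf_imp_cl: "H \<subseteq> T \<Longrightarrow> sf H T A \<Longrightarrow> cl T A"
  by (induction A) auto

text \<open>Implication is contravariant, yet a direct induction works: \<open>sf\<close> evaluates
  it through \<open>cl\<close> alone, and \<open>ht\<close> has that same condition as a
  conjunct.\<close>

lemma ht_imp_sf: "ht H T A \<Longrightarrow> sf H T A"
  by (induction A) auto

lemma HT_sound:
  assumes "A \<in> HT" "H \<subseteq> T"
  shows "ht H T A"
proof -
  have "hilbert {A \<^bold>\<or> (A \<^bold>\<rightarrow> B) \<^bold>\<or> \<^bold>\<not> B | A B. True} A"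
    using assms(1) by (simp add: HT_def)
  then show ?thesis
    \<comment> \<open>For the axiom of HT: if \<open>B\<close> fails in \<open>T\<close>, it fails
      at the lower node too and its negation is forced; otherwise the implication from
      \<open>A\<close> to \<open>B\<close> is forced unless \<open>A\<close> is.\<close>
    by (induction rule: hilbert.induct) (use ht_imp_cl[OF assms(2)] in auto)
qed

text \<open>Both nodes share one induction, as the implication rules at the lower node use premises
  at the upper one. A double negation is forced at the lower node iff its formula is true in
  \<open>T\<close>, which accounts for the \<open>NNs\<close> in these rules.\<close>

lemma SF_seq_sound:
  assumes "\<Gamma> \<turnstile> \<Delta>" "H \<subseteq> T"
  shows "(\<forall>A \<in> set \<Gamma>. cl T A) \<longrightarrow> (\<exists>A \<in> set \<Delta>. cl T A)"
    and "(\<forall>A \<in> set \<Gamma>. sf H T A) \<longrightarrow> (\<exists>A \<in> set \<Delta>. sf H T A)"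
proof -
  have "((\<forall>A \<in> set \<Gamma>. cl T A) \<longrightarrow> (\<exists>A \<in> set \<Delta>. cl T A)) \<and>
        ((\<forall>A \<in> set \<Gamma>. sf H T A) \<longrightarrow> (\<exists>A \<in> set \<Delta>. sf H T A))"
    using assms(1)
  proof (induction rule: SF_seq.induct)
    case (impL \<Gamma> \<Delta> A B \<Pi> \<Sigma>)
    then show ?case using sf_imp_cl[OF assms(2)] by (simp add: ball_Un bex_Un) blast
  next
    case (impR \<Gamma> A B \<Delta>)
    then show ?case using sf_imp_cl[OF assms(2)] by (auto simp: ball_Un bex_Un)
  qed (auto simp: ball_Un bex_Un)
  then show "(\<forall>A \<in> set \<Gamma>. cl T A) \<longrightarrow> (\<exists>A \<in> set \<Delta>. cl T A)"
    "(\<forall>A \<in> set \<Gamma>. sf H T A) \<longrightarrow> (\<exists>A \<in> set \<Delta>. sf H T A)" by blast+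
qed

lemma SF_sound: "A \<in> SF \<Longrightarrow> H \<subseteq> T \<Longrightarrow> sf H T A"
  using SF_seq_sound(2)[of "[]" "[A]" H T] by (simp add: SF_def)

primrec vars :: "'v form \<Rightarrow> 'v set" where
  "vars Bot = {}"
| "vars (Var p) = {p}"
| "vars (A \<^bold>\<and> B) = vars A \<union> vars B"
| "vars (A \<^bold>\<or> B) = vars A \<union> vars B"
| "vars (A \<^bold>\<rightarrow> B) = vars A \<union> vars B"

lemma finite_vars: "finite (vars A)"
  by (induction A) auto

section \<open>Completeness of CPC\<close>

lemma hilbert_mono: "hilbert X A \<Longrightarrow> X \<subseteq> Y \<Longrightarrow> hilbert Y A"
  by (induction rule: hilbert.induct) (auto intro: hilbert.intros)

lemma hilbert_weaken: "hilbert X B \<Longrightarrow> hilbert X (A \<^bold>\<rightarrow> B)"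
  by (rule hilbert.mp[OF hilbert.K])

lemma hilbert_imp_refl: "hilbert X (A \<^bold>\<rightarrow> A)"
  by (rule hilbert.mp[OF hilbert.mp[OF hilbert.S hilbert.K] hilbert.K[of X A A]])

lemma hilbert_deduction: "hilbert (insert A X) B \<Longrightarrow> hilbert X (A \<^bold>\<rightarrow> B)"
proof (induction rule: hilbert.induct)
  case (axiom B)
  then show ?case
    by (auto intro: hilbert_imp_refl hilbert_weaken hilbert.axiom)
next
  case (mp B C)
  then show ?case using hilbert.mp[OF hilbert.mp[OF hilbert.S]] by blast
qed (rule hilbert_weaken, rule hilbert.intros)+

text \<open>The instances of excluded middle stay fixed while the assumptions in \<open>X\<close>
  vary.\<close>

definition cpc :: "'v form set \<Rightarrow> 'v form \<Rightarrow> bool" where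
  "cpc X = hilbert (X \<union> {A \<^bold>\<or> \<^bold>\<not> A | A. True})"

lemma cpc_deduction: "cpc (insert A X) B \<Longrightarrow> cpc X (A \<^bold>\<rightarrow> B)"
  by (simp add: cpc_def hilbert_deduction)

lemma cpc_mp: "cpc X (A \<^bold>\<rightarrow> B) \<Longrightarrow> cpc X A \<Longrightarrow> cpc X B"
  unfolding cpc_def by (rule hilbert.mp)

lemma cpc_mono: "cpc X A \<Longrightarrow> X \<subseteq> Y \<Longrightarrow> cpc Y A"
  unfolding cpc_def by (erule hilbert_mono) blast

lemma cpc_assm: "A \<in> X \<Longrightarrow> cpc X A"
  by (simp add: cpc_def hilbert.axiom)

lemma cpc_conjI: "cpc X A \<Longrightarrow> cpc X B \<Longrightarrow> cpc X (A \<^bold>\<and> B)"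
  unfolding cpc_def by (rule hilbert.mp[OF hilbert.mp[OF hilbert.conjI]])

lemma cpc_conjE1: "cpc X (A \<^bold>\<and> B) \<Longrightarrow> cpc X A"
  unfolding cpc_def by (rule hilbert.mp[OF hilbert.conjE1])

lemma cpc_conjE2: "cpc X (A \<^bold>\<and> B) \<Longrightarrow> cpc X B"
  unfolding cpc_def by (rule hilbert.mp[OF hilbert.conjE2])

lemma cpc_disjI1: "cpc X A \<Longrightarrow> cpc X (A \<^bold>\<or> B)"
  unfolding cpc_def by (rule hilbert.mp[OF hilbert.disjI1])

lemma cpc_disjI2: "cpc X B \<Longrightarrow> cpc X (A \<^bold>\<or> B)"
  unfolding cpc_def by (rule hilbert.mp[OF hilbert.disjI2])

lemma cpc_botE: "cpc X Bot \<Longrightarrow> cpc X A"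
  unfolding cpc_def by (rule hilbert.mp[OF hilbert.botE])

lemma cpc_disjE:
  assumes "cpc X (A \<^bold>\<or> B)" "cpc X (A \<^bold>\<rightarrow> C)" "cpc X (B \<^bold>\<rightarrow> C)"
  shows "cpc X C"
  using assms unfolding cpc_def
  by (rule hilbert.mp[OF hilbert.mp[OF hilbert.mp[OF hilbert.disjE]], rotated 2])

text \<open>The one appeal to excluded middle in the completeness proof for CPC.\<close>

lemma cpc_cases:
  assumes "cpc (insert A X) B" "cpc (insert (\<^bold>\<not> A) X) B"
  shows "cpc X B"
proof (rule cpc_disjE)
  show "cpc X (A \<^bold>\<or> \<^bold>\<not> A)"
    by (auto simp: cpc_def intro: hilbert.axiom)
qed (use assms in \<open>auto intro: cpc_deduction\<close>)

section \<open>Kalmar's method for classical valuations\<close>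

definition cl_diagram :: "'v set \<Rightarrow> 'v set \<Rightarrow> 'v form set" where
  "cl_diagram T V = (\<lambda>p. if p \<in> T then Var p else \<^bold>\<not> (Var p)) ` V"

text \<open>Kalmar's lemma: each case of the induction derives the rows of the truth table of one
  connective.\<close>

lemma cpc_diagram:
  assumes "vars A \<subseteq> V"
  shows "if cl T A then cpc (cl_diagram T V) A else cpc (cl_diagram T V) (\<^bold>\<not> A)"
  using assms
proof (induction A)
  case Bot
  show ?case by (simp add: cpc_deduction cpc_assm)
next
  case (Var p)
  then show ?case by (auto simp: cl_diagram_def intro!: cpc_assm)
next
  case (And A B)
  have "cpc (cl_diagram T V) (\<^bold>\<not> (A \<^bold>\<and> B))" if "cpc (cl_diagram T V) (\<^bold>\<not> A)"
    by (rule cpc_deduction, rule cpc_mp[OF cpc_mono[OF that]], blast,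
        rule cpc_conjE1[OF cpc_assm], blast)
  moreover have "cpc (cl_diagram T V) (\<^bold>\<not> (A \<^bold>\<and> B))" if "cpc (cl_diagram T V) (\<^bold>\<not> B)"
    by (rule cpc_deduction, rule cpc_mp[OF cpc_mono[OF that]], blast,
        rule cpc_conjE2[OF cpc_assm], blast)
  ultimately show ?case using And by (auto intro: cpc_conjI)
next
  case (Or A B)
  have "cpc (cl_diagram T V) (\<^bold>\<not> (A \<^bold>\<or> B))"
    if "cpc (cl_diagram T V) (\<^bold>\<not> A)" "cpc (cl_diagram T V) (\<^bold>\<not> B)"
    by (rule cpc_deduction, rule cpc_disjE[OF cpc_assm], blast)
       (use that in \<open>auto elim: cpc_mono\<close>)
  then show ?case using Or by (auto intro: cpc_disjI1 cpc_disjI2)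
next
  case (Imp A B)
  have "cpc (cl_diagram T V) (A \<^bold>\<rightarrow> B)" if "cpc (cl_diagram T V) B"
    by (rule cpc_deduction, rule cpc_mono[OF that], blast)
  moreover have "cpc (cl_diagram T V) (A \<^bold>\<rightarrow> B)" if "cpc (cl_diagram T V) (\<^bold>\<not> A)"
    by (rule cpc_deduction, rule cpc_botE, rule cpc_mp[OF cpc_mono[OF that]], blast,
        rule cpc_assm, blast)
  moreover have "cpc (cl_diagram T V) (\<^bold>\<not> (A \<^bold>\<rightarrow> B))"
    if "cpc (cl_diagram T V) A" "cpc (cl_diagram T V) (\<^bold>\<not> B)"
    by (rule cpc_deduction, rule cpc_mp[OF cpc_mono[OF that(2)]], blast,
        rule cpc_mp[OF cpc_assm cpc_mono[OF that(1)]]) blast+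
  ultimately show ?case using Imp by auto
qed

text \<open>A case distinction on \<open>Var p\<close> merges diagrams that differ only at
  \<open>p\<close>, so variables disappear one at a time. \<open>X\<close> is arbitrary because the
  literal for \<open>p\<close> moves into it.\<close>

lemma cpc_eliminate_diagram:
  assumes "finite V" "\<And>T. cpc (X \<union> cl_diagram T V) A"
  shows "cpc X A"
  using assms
proof (induction V arbitrary: X rule: finite_induct)
  case empty
  then show ?case by (simp add: cl_diagram_def)
next
  case (insert p V)
  show ?case
  proof (rule cpc_cases[of "Var p"]; rule insert.IH)
    fix T
    \<comment> \<open>As \<open>p\<close> is not in \<open>V\<close>, adding it to \<open>T\<close>
      or removing it from \<open>T\<close> leaves the literals for \<open>V\<close>
      unchanged.\<close>
    show "cpc (insert (Var p) X \<union> cl_diagram T V) A"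
      by (rule cpc_mono[OF insert.prems[of "insert p T"]])
         (use insert.hyps in \<open>auto simp: cl_diagram_def split: if_splits\<close>)
    show "cpc (insert (\<^bold>\<not> (Var p)) X \<union> cl_diagram T V) A"
      by (rule cpc_mono[OF insert.prems[of "T - {p}"]])
         (use insert.hyps in \<open>auto simp: cl_diagram_def split: if_splits\<close>)
  qed
qed

lemma CPC_complete:
  assumes "\<And>T. cl T A"
  shows "A \<in> CPC"
proof -
  have "cpc {} A"
    by (rule cpc_eliminate_diagram[OF finite_vars[of A]])
       (use cpc_diagram[of A "vars A"] assms in simp)
  then show ?thesis by (simp add: CPC_def cpc_def)
qed

section \<open>Derivability in SF for sets of formulas\<close>

lemma SF_seq_to_frontL: "P @ X @ A # Y \<turnstile> \<Delta> \<Longrightarrow> P @ A # X @ Y \<turnstile> \<Delta>"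
proof (induction X arbitrary: Y rule: rev_induct)
  case (snoc B X)
  have "(P @ X) @ [B, A] @ Y \<turnstile> \<Delta>" using snoc.prems by simp
  then have "(P @ X) @ [A, B] @ Y \<turnstile> \<Delta>" by (rule SF_seq.exchL)
  then show ?case using snoc.IH[of "B # Y"] by simp
qed simp

lemma SF_seq_to_backR: "\<Gamma> \<turnstile> Y @ A # X @ P \<Longrightarrow> \<Gamma> \<turnstile> Y @ X @ A # P"
proof (induction X arbitrary: Y)
  case (Cons B X)
  have "\<Gamma> \<turnstile> Y @ [A, B] @ X @ P" using Cons.prems by simp
  then have "\<Gamma> \<turnstile> Y @ [B, A] @ X @ P" by (rule SF_seq.exchR)
  then show ?case using Cons.IH[of "Y @ [B]"] by simp
qed simp

lemma SF_seq_from_frontL: "A # X @ Y \<turnstile> \<Delta> \<Longrightarrow> X @ A # Y \<turnstile> \<Delta>"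
proof (induction X arbitrary: Y rule: rev_induct)
  case (snoc B X)
  have "X @ [A, B] @ Y \<turnstile> \<Delta>" using snoc by simp
  from SF_seq.exchL[OF this] show ?case by simp
qed simp

lemma SF_seq_from_backR: "\<Gamma> \<turnstile> Y @ X @ [A] \<Longrightarrow> \<Gamma> \<turnstile> Y @ A # X"
proof (induction X arbitrary: Y)
  case (Cons B X)
  have "\<Gamma> \<turnstile> Y @ [B, A] @ X" using Cons.IH[of "Y @ [B]"] Cons.prems by simp
  from SF_seq.exchR[OF this] show ?case by simp
qed simp

text \<open>Two copies of \<open>A\<close> move to the front and contract to one, which then returns
  to its place in \<open>X @ Y\<close>.\<close>

lemma SF_seq_absorbL:
  assumes "X @ A # Y \<turnstile> \<Delta>" "A \<in> set (X @ Y)"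
  shows "X @ Y \<turnstile> \<Delta>"
proof -
  obtain Z W where ZW: "X @ Y = Z @ A # W" using assms(2) by (meson split_list)
  have "A # Z @ A # W \<turnstile> \<Delta>"
    using SF_seq_to_frontL[of "[]" X A Y] assms(1) ZW by simp
  then have "A # A # Z @ W \<turnstile> \<Delta>" using SF_seq_to_frontL[of "[A]"] by simp
  then show ?thesis by (simp add: ZW SF_seq.contrL SF_seq_from_frontL)
qed

lemma SF_seq_absorbR:
  assumes "\<Gamma> \<turnstile> X @ A # Y" "A \<in> set (X @ Y)"
  shows "\<Gamma> \<turnstile> X @ Y"
proof -
  obtain Z W where ZW: "X @ Y = Z @ A # W" using assms(2) by (meson split_list)
  have "\<Gamma> \<turnstile> X @ Y @ [A]" using SF_seq_to_backR[of \<Gamma> X A Y "[]"] assms(1) by simp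
  also have "X @ Y @ [A] = Z @ A # W @ [A]" using ZW by (metis append.assoc append_Cons)
  finally have "\<Gamma> \<turnstile> (Z @ W) @ [A, A]" using SF_seq_to_backR[of \<Gamma> Z A W "[A]"] by simp
  then have "\<Gamma> \<turnstile> Z @ W @ [A]" using SF_seq.contrR by fastforce
  then show ?thesis by (simp add: ZW SF_seq_from_backR)
qed

text \<open>Weakening by all of \<open>\<Gamma>'\<close> comes first; each member of
  \<open>\<Gamma>\<close> then repeats one of \<open>\<Gamma>'\<close> and is absorbed.\<close>

lemma SF_seq_monoL:
  assumes "\<Gamma> \<turnstile> \<Delta>" "set \<Gamma> \<subseteq> set \<Gamma>'"
  shows "\<Gamma>' \<turnstile> \<Delta>"
proof -
  have "\<Gamma>' @ \<Gamma> \<turnstile> \<Delta>" using assms(1) by (induction \<Gamma>') (auto intro: SF_seq.weakL)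
  then show ?thesis using assms(2)
    by (induction \<Gamma>) (auto dest: SF_seq_absorbL)
qed

lemma SF_seq_monoR:
  assumes "\<Gamma> \<turnstile> \<Delta>" "set \<Delta> \<subseteq> set \<Delta>'"
  shows "\<Gamma> \<turnstile> \<Delta>'"
proof -
  have "\<Gamma> \<turnstile> \<Delta> @ \<Delta>'" using assms(1)
    by (induction \<Delta>' rule: rev_induct) (auto dest: SF_seq.weakR)
  then show ?thesis using assms(2)
    by (induction \<Delta>) (auto dest: SF_seq_absorbR[of _ "[]", simplified])
qed

lemma SF_seq_mono: "\<Gamma> \<turnstile> \<Delta> \<Longrightarrow> set \<Gamma> \<subseteq> set \<Gamma>' \<Longrightarrow> set \<Delta> \<subseteq> set \<Delta>' \<Longrightarrow> \<Gamma>' \<turnstile> \<Delta>'"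
  by (blast intro: SF_seq_monoL SF_seq_monoR)

text \<open>The structural rules make order and multiplicity irrelevant. Taking the lists from
  within \<open>S\<close> and \<open>T\<close> builds in weakening and admits infinite sets.\<close>

definition dv :: "'v form set \<Rightarrow> 'v form set \<Rightarrow> bool" where
  "dv S T \<longleftrightarrow> (\<exists>\<Gamma> \<Delta>. set \<Gamma> \<subseteq> S \<and> set \<Delta> \<subseteq> T \<and> \<Gamma> \<turnstile> \<Delta>)"

lemma dvI: "\<Gamma> \<turnstile> \<Delta> \<Longrightarrow> set \<Gamma> \<subseteq> S \<Longrightarrow> set \<Delta> \<subseteq> T \<Longrightarrow> dv S T"
  by (auto simp: dv_def)

lemma dv_set_iff: "dv (set \<Gamma>) (set \<Delta>) \<longleftrightarrow> \<Gamma> \<turnstile> \<Delta>"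
  by (auto simp: dv_def elim: SF_seq_mono)

lemma dv_mono: "dv S T \<Longrightarrow> S \<subseteq> S' \<Longrightarrow> T \<subseteq> T' \<Longrightarrow> dv S' T'"
  unfolding dv_def by blast

text \<open>Weakening and contraction make \<open>A\<close> occur at the head, where the left rules
  act.\<close>

lemma dvE_insertL:
  assumes "dv (insert A S) T"
  obtains \<Gamma> \<Delta> where "set \<Gamma> \<subseteq> S" "set \<Delta> \<subseteq> T" "A # \<Gamma> \<turnstile> \<Delta>"
proof -
  obtain \<Gamma> \<Delta> where *: "set \<Gamma> \<subseteq> insert A S" "set \<Delta> \<subseteq> T" "\<Gamma> \<turnstile> \<Delta>"
    using assms by (auto simp: dv_def)
  have "A # removeAll A \<Gamma> \<turnstile> \<Delta>" by (rule SF_seq_mono[OF *(3)]) auto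
  with * show thesis by (intro that) auto
qed

lemma dvE_insertR:
  assumes "dv S (insert A T)"
  obtains \<Gamma> \<Delta> where "set \<Gamma> \<subseteq> S" "set \<Delta> \<subseteq> T" "\<Gamma> \<turnstile> \<Delta> @ [A]"
proof -
  obtain \<Gamma> \<Delta> where *: "set \<Gamma> \<subseteq> S" "set \<Delta> \<subseteq> insert A T" "\<Gamma> \<turnstile> \<Delta>"
    using assms by (auto simp: dv_def)
  have "\<Gamma> \<turnstile> removeAll A \<Delta> @ [A]" by (rule SF_seq_mono[OF *(3)]) auto
  with * show thesis by (intro that) auto
qed

lemma dv_cut:
  assumes "dv S (insert A T)" "dv (insert A S) T"
  shows "dv S T"
  by (rule dvE_insertR[OF assms(1)], rule dvE_insertL[OF assms(2)],
      rule dvI, erule (1) SF_seq.cut) auto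

section \<open>Logical rules for sets of formulas\<close>

lemma dv_bot: "Bot \<in> S \<Longrightarrow> dv S T"
  by (rule dvI[OF SF_seq.init_bot]) auto

lemma dv_conjL: "dv (insert A (insert B S)) T \<Longrightarrow> dv (insert (A \<^bold>\<and> B) S) T"
proof (erule dvE_insertL)
  fix \<Gamma> \<Delta> assume *: "set \<Gamma> \<subseteq> insert B S" "set \<Delta> \<subseteq> T" "A # \<Gamma> \<turnstile> \<Delta>"
  \<comment> \<open>Each left rule replaces one conjunct, so both are applied, with \<open>B\<close>
    brought to the front in between; the two copies of the conjunction coincide in the set.\<close>
  have "B # (A \<^bold>\<and> B) # removeAll B \<Gamma> \<turnstile> \<Delta>"
    by (rule SF_seq_mono[OF SF_seq.conjL2[OF *(3), of B]]) auto
  then have "(A \<^bold>\<and> B) # (A \<^bold>\<and> B) # removeAll B \<Gamma> \<turnstile> \<Delta>" by (rule SF_seq.conjL1)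
  then show ?thesis by (rule dvI) (use * in auto)
qed

lemma dv_conjR:
  assumes "dv S (insert A T)" "dv S (insert B T)"
  shows "dv S (insert (A \<^bold>\<and> B) T)"
proof (rule dvE_insertR[OF assms(1)], rule dvE_insertR[OF assms(2)])
  fix \<Gamma> \<Delta> \<Gamma>' \<Delta>'
  assume *: "set \<Gamma> \<subseteq> S" "set \<Delta> \<subseteq> T" "\<Gamma> \<turnstile> \<Delta> @ [A]" "set \<Gamma>' \<subseteq> S" "set \<Delta>' \<subseteq> T" "\<Gamma>' \<turnstile> \<Delta>' @ [B]"
  have "\<Gamma> @ \<Gamma>' \<turnstile> (\<Delta> @ \<Delta>') @ [A \<^bold>\<and> B]"
    by (rule SF_seq.conjR; rule SF_seq_mono[OF *(3)] SF_seq_mono[OF *(6)]; auto)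
  then show ?thesis by (rule dvI) (use * in auto)
qed

lemma dv_disjL:
  assumes "dv (insert A S) T" "dv (insert B S) T"
  shows "dv (insert (A \<^bold>\<or> B) S) T"
proof (rule dvE_insertL[OF assms(1)], rule dvE_insertL[OF assms(2)])
  fix \<Gamma> \<Delta> \<Gamma>' \<Delta>'
  assume *: "set \<Gamma> \<subseteq> S" "set \<Delta> \<subseteq> T" "A # \<Gamma> \<turnstile> \<Delta>" "set \<Gamma>' \<subseteq> S" "set \<Delta>' \<subseteq> T" "B # \<Gamma>' \<turnstile> \<Delta>'"
  have "(A \<^bold>\<or> B) # (\<Gamma> @ \<Gamma>') \<turnstile> \<Delta> @ \<Delta>'"
    by (rule SF_seq.disjL; rule SF_seq_mono[OF *(3)] SF_seq_mono[OF *(6)]; auto)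
  then show ?thesis by (rule dvI) (use * in auto)
qed

lemma dv_disjR1: "dv S (insert A T) \<Longrightarrow> dv S (insert (A \<^bold>\<or> B) T)"
  by (erule dvE_insertR, rule dvI, erule SF_seq.disjR1) auto

lemma dv_disjR2: "dv S (insert B T) \<Longrightarrow> dv S (insert (A \<^bold>\<or> B) T)"
  by (erule dvE_insertR, rule dvI, erule SF_seq.disjR2) auto

text \<open>With an empty right side in the second premise, the rule introduces no double
  negations.\<close>

lemma dv_impL:
  assumes "dv S (insert A T)" "dv (insert B S) {}"
  shows "dv (insert (A \<^bold>\<rightarrow> B) S) T"
  by (rule dvE_insertR[OF assms(1)], rule dvE_insertL[OF assms(2)],
      rule dvI, rule SF_seq.impL) auto

lemma dv_impR:
  assumes "dv (insert A S) {\<^bold>\<not> \<^bold>\<not> B}"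
  shows "dv S {A \<^bold>\<rightarrow> B}"
proof (rule dvE_insertL[OF assms])
  fix \<Gamma> \<Delta> assume *: "set \<Gamma> \<subseteq> S" "set \<Delta> \<subseteq> {\<^bold>\<not> \<^bold>\<not> B}" "A # \<Gamma> \<turnstile> \<Delta>"
  have "\<Gamma> @ [A] \<turnstile> (\<^bold>\<not> \<^bold>\<not> B) # []" by (rule SF_seq_mono[OF *(3)]) (use * in auto)
  from SF_seq.impR[OF this] show ?thesis by (rule dvI) (use * in auto)
qed

lemma dv_negL: "dv S (insert A T) \<Longrightarrow> dv (insert (\<^bold>\<not> A) S) T"
  by (auto intro: dv_impL dv_bot)

text \<open>Weakening turns the empty right side into the double negation of \<open>Bot\<close> that
  \<open>dv_impR\<close> asks for.\<close>

lemma dv_negR: "dv (insert A S) {} \<Longrightarrow> dv S {\<^bold>\<not> A}"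
  by (rule dv_impR) (erule dv_mono; auto)

lemma dv_refl: "dv {A} {A}"
proof (induction A)
  case Bot
  show ?case by (simp add: dv_bot)
next
  case (Var p)
  show ?case by (rule dvI[OF SF_seq.init_var]) auto
next
  case (And A B)
  then show ?case by (intro dv_conjL dv_conjR) (auto elim: dv_mono)
next
  case (Or A B)
  then show ?case by (intro dv_disjL dv_disjR1 dv_disjR2)
next
  case (Imp A B)
  \<comment> \<open>The left rule doubly negates \<open>B\<close>, which is exactly the form that
    the right rule takes as its premise.\<close>
  have "[A] @ [A \<^bold>\<rightarrow> B] @ [] \<turnstile> [] @ NNs [B]"
  proof (rule SF_seq.impL)
    show "[A] \<turnstile> [] @ [A]" "[B] \<turnstile> [B]" using Imp by (simp_all flip: dv_set_iff)
  qed
  then have "dv {A, A \<^bold>\<rightarrow> B} {\<^bold>\<not> \<^bold>\<not> B}" by (rule dvI) auto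
  then show ?case by (rule dv_impR)
qed

lemma dv_id: "A \<in> S \<Longrightarrow> A \<in> T \<Longrightarrow> dv S T"
  using dv_refl[of A] by (rule dv_mono) auto

lemma dv_contradiction: "A \<in> S \<Longrightarrow> \<^bold>\<not> A \<in> S \<Longrightarrow> dv S T"
  by (metis dv_id dv_negL insertI1 insert_absorb)

text \<open>A cut on the negation of \<open>A\<close>. The right side is empty because
  \<open>dv_negR\<close> admits no side formulas there.\<close>

lemma dv_neg_cases:
  assumes "dv (insert A S) {}" "dv (insert (\<^bold>\<not> A) S) {}"
  shows "dv S {}"
  by (rule dv_cut[OF dv_negR[OF assms(1)] assms(2)])

section \<open>Completeness of SF\<close>

text \<open>Derivability with an empty right side is classical; no double negations arise there.\<close>

lemma dv_classical:
  assumes "\<And>p. p \<in> V \<Longrightarrow> if p \<in> T then dv (insert (\<^bold>\<not> (Var p)) S) {} else dv (insert (Var p) S) {}"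
    and "vars A \<subseteq> V"
  shows "if cl T A then dv (insert (\<^bold>\<not> A) S) {} else dv (insert A S) {}"
  using assms(2)
proof (induction A)
  case Bot
  show ?case by (simp add: dv_bot)
next
  case (Var p)
  then show ?case using assms by simp
next
  case (And A B)
  have "dv (insert (\<^bold>\<not> (A \<^bold>\<and> B)) S) {}" if A: "dv (insert (\<^bold>\<not> A) S) {}" and B: "dv (insert (\<^bold>\<not> B) S) {}"
  \<comment> \<open>The empty right side permits classical case distinctions, here on
    \<open>A\<close> and then on \<open>B\<close>.\<close>
  proof (rule dv_neg_cases[of A])
    show "dv (insert (\<^bold>\<not> A) (insert (\<^bold>\<not> (A \<^bold>\<and> B)) S)) {}" using A by (rule dv_mono) auto
    show "dv (insert A (insert (\<^bold>\<not> (A \<^bold>\<and> B)) S)) {}"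
    proof (rule dv_neg_cases[of B])
      show "dv (insert (\<^bold>\<not> B) (insert A (insert (\<^bold>\<not> (A \<^bold>\<and> B)) S))) {}" using B by (rule dv_mono) auto
      have "dv (insert (\<^bold>\<not> (A \<^bold>\<and> B)) (insert B (insert A S))) {}"
        by (intro dv_negL dv_conjR dv_id) auto
      then show "dv (insert B (insert A (insert (\<^bold>\<not> (A \<^bold>\<and> B)) S))) {}" by (rule dv_mono) auto
    qed
  qed
  moreover have "dv (insert (A \<^bold>\<and> B) S) {}" if "dv (insert A S) {} \<or> dv (insert B S) {}"
    by (rule dv_conjL) (use that in \<open>auto elim: dv_mono\<close>)
  ultimately show ?case using And by (auto split: if_splits)
next
  case (Or A B)
  have "dv (insert (\<^bold>\<not> (A \<^bold>\<or> B)) S) {}" if "dv (insert (\<^bold>\<not> C) S) {}" "C = A \<or> C = B" for C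
  proof (rule dv_neg_cases[of C])
    show "dv (insert (\<^bold>\<not> C) (insert (\<^bold>\<not> (A \<^bold>\<or> B)) S)) {}" using that(1) by (rule dv_mono) auto
    have "dv (insert (\<^bold>\<not> (A \<^bold>\<or> B)) (insert C S)) {}"
      using that(2) by (auto intro: dv_negL dv_disjR1 dv_disjR2 dv_id)
    then show "dv (insert C (insert (\<^bold>\<not> (A \<^bold>\<or> B)) S)) {}" by (simp add: insert_commute)
  qed
  then show ?case using Or by (auto intro: dv_disjL split: if_splits)
next
  case (Imp A B)
  have "dv (insert (\<^bold>\<not> (A \<^bold>\<rightarrow> B)) S) {}" if "dv (insert A S) {} \<or> dv (insert (\<^bold>\<not> B) S) {}"
    \<comment> \<open>The right rule asks only for the double negation of \<open>B\<close>, so it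
      suffices to refute \<open>A\<close> together with the negation of \<open>B\<close>.\<close>
    by (rule dv_negL, rule dv_impR, rule dv_negR) (use that in \<open>auto elim: dv_mono\<close>)
  moreover have "dv (insert (A \<^bold>\<rightarrow> B) S) {}" if "dv (insert (\<^bold>\<not> A) S) {}" "dv (insert B S) {}"
  proof (rule dv_neg_cases[of A])
    show "dv (insert (\<^bold>\<not> A) (insert (A \<^bold>\<rightarrow> B) S)) {}" using that(1) by (rule dv_mono) auto
    have "dv (insert (A \<^bold>\<rightarrow> B) (insert A S)) {}"
      by (rule dv_impL, rule dv_id) (use that(2) in \<open>auto elim: dv_mono\<close>)
    then show "dv (insert A (insert (A \<^bold>\<rightarrow> B) S)) {}" by (simp add: insert_commute)
  qed
  ultimately show ?case using Imp by (auto split: if_splits)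
qed

text \<open>The first assumption settles variables at the upper node, the second at the lower node
  relative to \<open>R\<close>. Implication goes through the first by \<open>dv_classical\<close>,
  as \<open>sf\<close> evaluates it in \<open>T\<close>; the other connectives follow the
  second.\<close>

lemma dv_truth:
  assumes "\<And>p. p \<in> V \<Longrightarrow> if p \<in> T then dv (insert (\<^bold>\<not> (Var p)) S) {} else dv (insert (Var p) S) {}"
    and "\<And>p. p \<in> V \<Longrightarrow> if p \<in> H then dv S (insert (Var p) R) else dv (insert (Var p) S) R"
    and "vars A \<subseteq> V"
  shows "if sf H T A then dv S (insert A R) else dv (insert A S) R"
  using assms(3)
proof (induction A)
  case Bot
  show ?case by (simp add: dv_bot)
next
  case (Var p)
  then show ?case using assms by simp
next
  case (And A B)
  then show ?case
    by (auto intro: dv_conjR dv_conjL elim: dv_mono split: if_splits)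
next
  case (Or A B)
  then show ?case
    by (auto intro: dv_disjR1 dv_disjR2 dv_disjL split: if_splits)
next
  case (Imp A B)
  have c: "if cl T A then dv (insert (\<^bold>\<not> A) S) {} else dv (insert A S) {}"
    "if cl T B then dv (insert (\<^bold>\<not> B) S) {} else dv (insert B S) {}"
    by (rule dv_classical[OF assms(1)]; use Imp.prems in auto)+
  have "dv S (insert (A \<^bold>\<rightarrow> B) R)" if "cl T A \<longrightarrow> cl T B"
  proof -
    have "dv S {A \<^bold>\<rightarrow> B}"
      by (rule dv_impR, rule dv_negR) (use that c in \<open>auto elim: dv_mono split: if_splits\<close>)
    then show ?thesis by (rule dv_mono) auto
  qed
  moreover have "dv (insert (A \<^bold>\<rightarrow> B) S) R" if "\<not> (cl T A \<longrightarrow> cl T B)"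
    using dv_classical[OF assms(1) Imp.prems] that by (auto elim: dv_mono)
  ultimately show ?case by auto
qed

text \<open>For \<open>H \<subseteq> T\<close> the three forms match the three values of a variable:
  forced at both nodes, at the upper one only, or at neither.\<close>

definition sf_literal :: "'v set \<Rightarrow> 'v set \<Rightarrow> 'v \<Rightarrow> 'v form" where
  "sf_literal H T p =
    (if p \<in> H then Var p else if p \<in> T then \<^bold>\<not> \<^bold>\<not> (Var p) else \<^bold>\<not> (Var p))"

text \<open>Variables forced only at the upper node also have to appear on the right side of the
  diagram, as no formula expresses that they fail at the lower node.\<close>

lemma dv_diagram:
  assumes "H \<subseteq> T" "sf H T A"
  shows "dv (sf_literal H T ` vars A) (insert A (Var ` (vars A \<inter> (T - H))))"
proof -
  let ?S = "sf_literal H T ` vars A" and ?R = "Var ` (vars A \<inter> (T - H))"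
  have lit: "sf_literal H T p \<in> ?S" if "p \<in> vars A" for p using that by blast
  have "if sf H T A then dv ?S (insert A ?R) else dv (insert A ?S) ?R"
  proof (rule dv_truth[OF _ _ subset_refl])
    fix p assume p: "p \<in> vars A"
    show "if p \<in> T then dv (insert (\<^bold>\<not> (Var p)) ?S) {} else dv (insert (Var p) ?S) {}"
      using lit[OF p] assms(1) dv_contradiction[of "Var p"] dv_contradiction[of "\<^bold>\<not> (Var p)"]
      by (auto simp: sf_literal_def[of _ _ p] split: if_splits)
    \<comment> \<open>For \<open>p\<close> in \<open>T - H\<close> the variable stands on both
      sides; for \<open>p\<close> outside \<open>T\<close> it contradicts its literal.\<close>
    show "if p \<in> H then dv ?S (insert (Var p) ?R) else dv (insert (Var p) ?S) ?R"
      using lit[OF p] p dv_contradiction[of "Var p"]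
      by (auto simp: sf_literal_def[of _ _ p] intro!: dv_id[of "Var p"] split: if_splits)
  qed
  with assms(2) show ?thesis by simp
qed

text \<open>Weak excluded middle as a sequent. The right rule for implication, used with a side
  formula, yields it with a triple negation, which a cut reduces to a single one.\<close>

lemma dv_neg_neg_or_neg: "dv S (insert (\<^bold>\<not> A) (insert (\<^bold>\<not> \<^bold>\<not> A) T))"
proof -
  have "[] @ [\<^bold>\<not> A] \<turnstile> \<^bold>\<not> \<^bold>\<not> Bot # [\<^bold>\<not> A]"
    by (auto simp flip: dv_set_iff intro: dv_id)
  then have "[] \<turnstile> \<^bold>\<not> \<^bold>\<not> A # NNs [\<^bold>\<not> A]" by (rule SF_seq.impR)
  then have "dv S (insert (\<^bold>\<not> \<^bold>\<not> \<^bold>\<not> A) (insert (\<^bold>\<not> A) (insert (\<^bold>\<not> \<^bold>\<not> A) T)))" by (rule dvI) auto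
  moreover have "dv (insert (\<^bold>\<not> \<^bold>\<not> \<^bold>\<not> A) S) {\<^bold>\<not> A}"
  proof (rule dv_negR)
    have "dv (insert (\<^bold>\<not> \<^bold>\<not> \<^bold>\<not> A) (insert A S)) {}"
      by (intro dv_negL dv_negR dv_contradiction[of A]) auto
    then show "dv (insert A (insert (\<^bold>\<not> \<^bold>\<not> \<^bold>\<not> A) S)) {}" by (simp add: insert_commute)
  qed
  then have "dv (insert (\<^bold>\<not> \<^bold>\<not> \<^bold>\<not> A) S) (insert (\<^bold>\<not> A) (insert (\<^bold>\<not> \<^bold>\<not> A) T))" by (rule dv_mono) auto
  ultimately show ?thesis by (rule dv_cut)
qed

text \<open>The counterpart of \<open>cpc_cases\<close> for three values. In the middle case the
  extra \<open>A\<close> on the right is cut against the first case; weak excluded middle then joins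
  the remaining two.\<close>

lemma dv_three_cases:
  assumes "dv (insert A S) T" "dv (insert (\<^bold>\<not> \<^bold>\<not> A) S) (insert A T)" "dv (insert (\<^bold>\<not> A) S) T"
  shows "dv S T"
proof -
  have nn: "dv (insert (\<^bold>\<not> \<^bold>\<not> A) S) T"
    by (rule dv_cut[OF assms(2)]) (use assms(1) in \<open>auto elim: dv_mono\<close>)
  have "dv S (insert (\<^bold>\<not> \<^bold>\<not> A) T)"
    by (rule dv_cut[OF dv_neg_neg_or_neg]) (use assms(3) in \<open>auto elim: dv_mono\<close>)
  then show ?thesis using nn by (rule dv_cut)
qed

text \<open>Variables disappear one at a time as for CPC. Here \<open>Y\<close> is arbitrary as
  well, because the middle case adds \<open>Var p\<close> on the right.\<close>

lemma dv_eliminate_diagram: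
  assumes "finite V"
    and "\<And>H T. H \<subseteq> T \<Longrightarrow> dv (X \<union> sf_literal H T ` V) (Y \<union> Var ` (V \<inter> (T - H)))"
  shows "dv X Y"
  using assms
proof (induction V arbitrary: X Y rule: finite_induct)
  case empty
  then show ?case by auto
next
  case (insert p V)
  have lit: "sf_literal H' T' q = sf_literal H T q" if "q \<in> V" "H' - {p} = H - {p}" "T' - {p} = T - {p}"
    for q H T H' T'
  proof -
    have "q \<noteq> p" using that(1) insert.hyps by blast
    then have "q \<in> H' \<longleftrightarrow> q \<in> H" "q \<in> T' \<longleftrightarrow> q \<in> T" using that(2,3) by blast+
    then show ?thesis by (simp add: sf_literal_def)
  qed
  \<comment> \<open>\<open>H'\<close> and \<open>T'\<close> assign \<open>p\<close> a chosen value
    and agree with \<open>H\<close> and \<open>T\<close> elsewhere; the three values give the three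
    cases below.\<close>
  have step: "dv (insert (sf_literal H' T' p) X \<union> sf_literal H T ` V)
      ((if p \<in> T' - H' then insert (Var p) Y else Y) \<union> Var ` (V \<inter> (T - H)))"
    if "H' \<subseteq> T'" "H' - {p} = H - {p}" "T' - {p} = T - {p}" for H T H' T'
  proof (rule dv_mono[OF insert.prems[OF that(1)]])
    show "X \<union> sf_literal H' T' ` insert p V \<subseteq> insert (sf_literal H' T' p) X \<union> sf_literal H T ` V"
      using lit[OF _ that(2,3)] by auto
    have "V \<inter> (T' - H') = V \<inter> (T - H)" using that(2,3) insert.hyps by blast
    then show "Y \<union> Var ` (insert p V \<inter> (T' - H'))
        \<subseteq> (if p \<in> T' - H' then insert (Var p) Y else Y) \<union> Var ` (V \<inter> (T - H))"
      by auto
  qed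
  show ?case
  proof (rule dv_three_cases[of "Var p"]; rule insert.IH)
    fix H T :: "'a set" assume "H \<subseteq> T"
    then show "dv (insert (Var p) X \<union> sf_literal H T ` V) (Y \<union> Var ` (V \<inter> (T - H)))"
      using step[of "insert p H" "insert p T" H T] by (auto simp: sf_literal_def[of _ _ p])
    show "dv (insert (\<^bold>\<not> \<^bold>\<not> (Var p)) X \<union> sf_literal H T ` V)
        (insert (Var p) Y \<union> Var ` (V \<inter> (T - H)))"
      using step[of "H - {p}" "insert p T" H T] \<open>H \<subseteq> T\<close> by (auto simp: sf_literal_def[of _ _ p])
    show "dv (insert (\<^bold>\<not> (Var p)) X \<union> sf_literal H T ` V) (Y \<union> Var ` (V \<inter> (T - H)))"
      using step[of "H - {p}" "T - {p}" H T] \<open>H \<subseteq> T\<close> by (auto simp: sf_literal_def[of _ _ p])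
  qed
qed

lemma SF_complete:
  assumes "\<And>H T. H \<subseteq> T \<Longrightarrow> sf H T A"
  shows "A \<in> SF"
proof -
  have "dv {} {A}"
    by (rule dv_eliminate_diagram[OF finite_vars[of A]])
       (simp add: dv_diagram assms)
  then show ?thesis using dv_set_iff[of "[]" "[A]"] by (simp add: SF_def)
qed

section \<open>The strict inclusions\<close>

theorem mainTheorem4:
  shows "(HT :: ('v :: countable) form set) \<subset> SF \<and> (SF :: 'v form set) \<subset> CPC"
proof
  fix p :: 'v
  let ?dne = "\<^bold>\<not> \<^bold>\<not> (Var p) \<^bold>\<rightarrow> Var p" and ?em = "Var p \<^bold>\<or> \<^bold>\<not> (Var p)"
  have "(HT :: 'v form set) \<subseteq> SF"
    by (auto intro: SF_complete ht_imp_sf HT_sound)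
  moreover have "?dne \<in> SF" by (rule SF_complete) simp
  \<comment> \<open>The model with \<open>p\<close> only at the upper node separates both pairs of
    logics: its lower node forces the double negation of \<open>p\<close>, but neither
    \<open>p\<close> nor its negation.\<close>
  moreover have "?dne \<notin> HT"
    using HT_sound[of ?dne "{}" "{p}"] by auto
  ultimately show "(HT :: 'v form set) \<subset> SF" by blast
  have "(SF :: 'v form set) \<subseteq> CPC"
    by (auto intro: CPC_complete sf_imp_cl SF_sound)
  moreover have "?em \<in> CPC" by (rule CPC_complete) simp
  moreover have "?em \<notin> SF"
    using SF_sound[of ?em "{}" "{p}"] by auto
  ultimately show "(SF :: 'v form set) \<subset> CPC" by blast
qed

end
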